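(* Let $k\ge 1$ be an integer and let $A_{k,n}$ denote the number of uniquely $k$-determined $n$-permutations. Then the generating function $A_k(x)=\sum_{n\ge 0}A_{k,n}x^n$ is rational, i.e. it is the power series expansion of a rational function of $x$.
   Context: An $n$-permutation is a permutation of $\{1,\ldots,n\}$ written as a word $\pi=\pi_1\pi_2\ldots\pi_n$. The pattern formed by a word of $k$ distinct integers is the unique $k$-permutation order-isomorphic to it. Graph of patterns overlaps $\mathcal{P}_k$: its nodes are all $k!$ $k$-permutations, and there is an arc from $a_1\ldots a_k$ to $b_1\ldots b_k$ if and only if $a_2\ldots a_k$ and $b_1\ldots b_{k-1}$ form the same pattern. For $n\ge k$, the path in $\mathcal{P}_k$ corresponding to an $n$-permutation $\pi$ is the sequence of $n-k+1$ nodes whose $i$-th term is the pattern formed by $\pi_i\pi_{i+1}\ldots\pi_{i+k-1}$, $i=1,\ldots,n-k+1$. For $n\ge k$, an $n$-permutation $\pi$ is uniquely $k$-determined if no other $n$-permutation has the same corresponding path in $\mathcal{P}_k$. For $0\le n<k$, every $n$-permutation is regarded as uniquely $k$-determined, so $A_{k,n}=n!$ for $n<k$. *)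

theory Defs
  imports
    "HOL-Combinatorics.Multiset_Permutations"
    "HOL-Computational_Algebra.Polynomial_FPS"
begin

text \<open>A permutation of \<open>{1..n}\<close> is a word, that is, a duplicate-free list with set of
  entries \<open>{1..n}\<close>.\<close>

abbreviation perms :: "nat \<Rightarrow> nat list set" where
  "perms n \<equiv> permutations_of_set {1..n}"

definition order_isomorphic :: "nat list \<Rightarrow> nat list \<Rightarrow> bool" where
  "order_isomorphic v w \<longleftrightarrow> length v = length w \<and>
     (\<forall>i<length v. \<forall>j<length v. v ! i < v ! j \<longleftrightarrow> w ! i < w ! j)"

text \<open>Only meaningful for duplicate-free words; see \<open>ex1_pattern\<close> below.\<close>

definition pattern_of :: "nat list \<Rightarrow> nat list" where
  "pattern_of w = (THE p. p \<in> perms (length w) \<and> order_isomorphic w p)"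

definition overlap_arcs :: "nat \<Rightarrow> (nat list \<times> nat list) set" where
  "overlap_arcs k =
     {(a, b). a \<in> perms k \<and> b \<in> perms k \<and> pattern_of (tl a) = pattern_of (butlast b)}"

text \<open>Positions are counted from 0. The result is intended for \<open>k \<le> length \<pi>\<close>, and
  then has length \<open>length \<pi> - k + 1\<close>.\<close>

definition overlap_path :: "nat \<Rightarrow> nat list \<Rightarrow> nat list list" where
  "overlap_path k \<pi> = map (\<lambda>i. pattern_of (take k (drop i \<pi>))) [0..<length \<pi> + 1 - k]"

definition uniquely_determined :: "nat \<Rightarrow> nat \<Rightarrow> nat list \<Rightarrow> bool" where
  "uniquely_determined k n \<pi> \<longleftrightarrow> \<pi> \<in> perms n \<and>
     (k \<le> n \<longrightarrow> \<not> (\<exists>\<sigma>\<in>perms n. \<sigma> \<noteq> \<pi> \<and> overlap_path k \<sigma> = overlap_path k \<pi>))"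

definition num_uniquely_determined :: "nat \<Rightarrow> nat \<Rightarrow> nat" where
  "num_uniquely_determined k n = card {\<pi>. uniquely_determined k n \<pi>}"

definition gf_uniquely_determined :: "nat \<Rightarrow> rat fps" where
  "gf_uniquely_determined k = Abs_fps (\<lambda>n. of_nat (num_uniquely_determined k n))"

text \<open>A rational function has a power series expansion at 0 if its denominator, in lowest terms,
  does not vanish there; the division is then by an invertible power series.\<close>

definition rational_fps :: "'a::field fps \<Rightarrow> bool" where
  "rational_fps F \<longleftrightarrow>
     (\<exists>p q :: 'a poly. coeff q 0 \<noteq> 0 \<and> F = fps_of_poly p / fps_of_poly q)"

lemma order_isomorphic_perm_nth:
  assumes p: "p \<in> perms (length w)" and iso: "order_isomorphic w p" and i: "i < length w"
  shows "p ! i = card {j. j < length w \<and> w ! j \<le> w ! i}"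
proof -
  have sp: "set p = {1..length w}" and dp: "distinct p"
    using p by (auto simp: permutations_of_set_def)
  have l: "length p = length w" using iso by (simp add: order_isomorphic_def)
  have eq: "{j. j < length w \<and> w ! j \<le> w ! i} = {j. j < length w \<and> p ! j \<le> p ! i}"
    using iso i by (auto simp: order_isomorphic_def simp flip: linorder_not_less)
  have pi: "p ! i \<in> {1..length w}" using sp i l nth_mem by metis
  have "bij_betw ((!) p) {j. j < length w \<and> p ! j \<le> p ! i} {1..p ! i}"
  proof (rule bij_betwI')
    fix x y assume "x \<in> {j. j < length w \<and> p ! j \<le> p ! i}" "y \<in> {j. j < length w \<and> p ! j \<le> p ! i}"
    then show "(p ! x = p ! y) = (x = y)" using dp l by (auto simp: nth_eq_iff_index_eq)
  next
    fix x assume "x \<in> {j. j < length w \<and> p ! j \<le> p ! i}"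
    then show "p ! x \<in> {1..p ! i}" using sp l nth_mem[of x p] by auto
  next
    fix y assume y: "y \<in> {1..p ! i}"
    then have "y \<in> set p" using pi sp by auto
    then show "\<exists>x\<in>{j. j < length w \<and> p ! j \<le> p ! i}. y = p ! x"
      using y l by (auto simp: in_set_conv_nth)
  qed
  then show ?thesis using bij_betw_same_card eq by fastforce
qed

lemma ex1_pattern:
  assumes "distinct w"
  shows "\<exists>!p. p \<in> perms (length w) \<and> order_isomorphic w p"
proof (rule ex_ex1I)
  let ?A = "\<lambda>x. {j. j < length w \<and> w ! j \<le> x}"
  let ?p = "map (\<lambda>x. card (?A x)) w"
  have mono: "card (?A (w ! i)) < card (?A (w ! j))" if "i < length w" "j < length w" "w ! i < w ! j" for i j
  proof (rule psubset_card_mono)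
    have "?A (w ! i) \<subseteq> ?A (w ! j)"
      using that(3) by (auto intro: order.trans less_imp_le)
    moreover have "j \<in> ?A (w ! j)" "j \<notin> ?A (w ! i)" using that by simp_all
    ultimately show "?A (w ! i) \<subset> ?A (w ! j)" by blast
  qed simp
  have iso: "order_isomorphic w ?p"
  proof -
    have "w ! i < w ! j \<longleftrightarrow> card (?A (w ! i)) < card (?A (w ! j))"
      if "i < length w" "j < length w" for i j
      using mono[of i j] mono[of j i] that
      by (cases "w ! i" "w ! j" rule: linorder_cases) simp_all
    then show ?thesis by (simp add: order_isomorphic_def)
  qed
  have d: "distinct ?p"
  proof -
    have "card (?A (w ! i)) \<noteq> card (?A (w ! j))"
      if "i < length w" "j < length w" "i \<noteq> j" for i j
      using mono[of i j] mono[of j i] that nth_eq_iff_index_eq[OF assms, of i j]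
      by (cases "w ! i" "w ! j" rule: linorder_cases) simp_all
    then show ?thesis by (simp add: distinct_conv_nth)
  qed
  have "set ?p \<subseteq> {1..length w}"
  proof
    fix y assume "y \<in> set ?p"
    then obtain i where i: "i < length w" "y = card (?A (w ! i))" by (auto simp: in_set_conv_nth)
    have "i \<in> ?A (w ! i)" using i by auto
    then have "0 < card (?A (w ! i))" by (auto simp: card_gt_0_iff)
    moreover have "card (?A (w ! i)) \<le> card {..<length w}" by (rule card_mono) auto
    ultimately show "y \<in> {1..length w}" using i by auto
  qed
  moreover have "card (set ?p) = length w" using distinct_card[OF d] by simp
  ultimately have "set ?p = {1..length w}" by (simp add: card_subset_eq)
  then show "\<exists>p. p \<in> perms (length w) \<and> order_isomorphic w p"
    using iso d by (auto simp: permutations_of_set_def simp del: distinct_map set_map)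
next
  fix p q
  assume p: "p \<in> perms (length w) \<and> order_isomorphic w p"
    and q: "q \<in> perms (length w) \<and> order_isomorphic w q"
  have l: "length p = length w" "length q = length w"
    using p q by (simp_all add: order_isomorphic_def)
  show "p = q"
  proof (rule nth_equalityI)
    show "length p = length q" using l by simp
    fix i assume "i < length p"
    then show "p ! i = q ! i"
      using p q l order_isomorphic_perm_nth[of p w i] order_isomorphic_perm_nth[of q w i] by simp
  qed
qed

lemma pattern_of:
  assumes "distinct w"
  shows "pattern_of w \<in> perms (length w)" "order_isomorphic w (pattern_of w)"
  using theI'[OF ex1_pattern[OF assms]] by (auto simp: pattern_of_def)

lemma pattern_of_eqI:
  assumes "distinct v" "distinct w" "order_isomorphic v w"
  shows "pattern_of v = pattern_of w"
proof -
  have "length v = length w" using assms(3) by (simp add: order_isomorphic_def)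
  moreover have "order_isomorphic v (pattern_of w)"
    using assms(3) pattern_of(2)[OF assms(2)] unfolding order_isomorphic_def by auto
  ultimately show ?thesis
    using ex1_pattern[OF assms(1)] pattern_of[OF assms(1)] pattern_of(1)[OF assms(2)] by metis
qed

text \<open>\<open>overlap_path k \<pi>\<close> is indeed a path in the graph of overlapping patterns.\<close>

lemma overlap_path_walk:
  assumes "\<pi> \<in> perms n" "1 \<le> k" "k \<le> n"
  shows "length (overlap_path k \<pi>) = n - k + 1"
    and "set (overlap_path k \<pi>) \<subseteq> perms k"
    and "Suc i < n - k + 1 \<Longrightarrow> (overlap_path k \<pi> ! i, overlap_path k \<pi> ! Suc i) \<in> overlap_arcs k"
proof -
  have d: "distinct \<pi>" and l: "length \<pi> = n"
    using assms(1) distinct_card[of \<pi>] by (auto simp: permutations_of_set_def)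
  show len: "length (overlap_path k \<pi>) = n - k + 1" using l assms by (simp add: overlap_path_def)
  let ?w = "\<lambda>i. take k (drop i \<pi>)"
  have dw: "distinct (?w i)" for i using d by simp
  have lw: "length (?w i) = k" if "i < n - k + 1" for i using that l assms by simp
  have node: "pattern_of (?w i) \<in> perms k" if "i < n - k + 1" for i
    using pattern_of(1)[OF dw[of i]] lw[OF that] by simp
  have nth: "overlap_path k \<pi> ! i = pattern_of (?w i)" if "i < n - k + 1" for i
  proof -
    have "i < n + 1 - k" using that assms by simp
    then show ?thesis by (simp add: overlap_path_def l del: upt_Suc)
  qed
  show "set (overlap_path k \<pi>) \<subseteq> perms k"
    using node l assms by (auto simp: overlap_path_def)
  show "(overlap_path k \<pi> ! i, overlap_path k \<pi> ! Suc i) \<in> overlap_arcs k" if i: "Suc i < n - k + 1"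
  proof -
    have i': "i < n - k + 1" using i by simp
    let ?a = "pattern_of (?w i)" and ?b = "pattern_of (?w (Suc i))"
    have a: "order_isomorphic (?w i) ?a" and b: "order_isomorphic (?w (Suc i)) ?b"
      using pattern_of(2)[OF dw] by blast+
    have da: "distinct ?a" and db: "distinct ?b"
      using node[OF i'] node[OF i] by (auto simp: permutations_of_set_def)
    have la: "length ?a = k" and lb: "length ?b = k"
      using a b lw[OF i'] lw[OF i] by (auto simp: order_isomorphic_def)
    have A: "(\<pi> ! (i + x) < \<pi> ! (i + y)) = (?a ! x < ?a ! y)" if "x < k" "y < k" for x y
      using a that lw[OF i'] l i unfolding order_isomorphic_def by auto
    have B: "(\<pi> ! (Suc i + x) < \<pi> ! (Suc i + y)) = (?b ! x < ?b ! y)" if "x < k" "y < k" for x y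
      using b that lw[OF i] l i unfolding order_isomorphic_def by auto
    have "order_isomorphic (tl ?a) (butlast ?b)"
      unfolding order_isomorphic_def
    proof (intro conjI allI impI)
      show "length (tl ?a) = length (butlast ?b)" using la lb by simp
      fix x y assume "x < length (tl ?a)" "y < length (tl ?a)"
      then show "(tl ?a ! x < tl ?a ! y) = (butlast ?b ! x < butlast ?b ! y)"
        using A[of "Suc x" "Suc y"] B[of x y] la lb by (simp add: nth_tl nth_butlast)
    qed
    then have "pattern_of (tl ?a) = pattern_of (butlast ?b)"
      using da db by (intro pattern_of_eqI) (auto simp: distinct_tl distinct_butlast)
    then show ?thesis
      using node[OF i'] node[OF i] nth[OF i'] nth[OF i] by (simp add: overlap_arcs_def)
  qed
qed

end

theory Submission
  imports Defs
begin

text \<open>The path of \<open>\<pi>\<close> in the graph records exactly the order of the entries at distance less than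
  \<open>k\<close>. Hence \<open>\<pi>\<close> is uniquely \<open>k\<close>-determined iff any two entries with consecutive values are at
  distance less than \<open>k\<close>: such entries force the whole order, whereas entries farther apart can be
  swapped without changing the path. This condition passes to factors, and it holds for \<open>\<pi>\<close> if it
  holds for all factors of length \<open>2 * k + 1\<close>. So the possible extensions of \<open>\<pi>\<close> on the right
  depend only on the pattern of its last \<open>2 * k + 1\<close> entries, and counting becomes a
  transfer-matrix problem, i.e. a linear system over the rational power series.\<close>

section \<open>Rational power series\<close>

text \<open>A polynomial with nonzero constant term is a unit among power series, so the quotient
  can be cleared. This turns the closure properties below into polynomial identities.\<close>

lemma rational_fps_iff:
  "rational_fps F \<longleftrightarrow> (\<exists>p q. coeff q 0 \<noteq> 0 \<and> F * fps_of_poly q = fps_of_poly p)"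
proof -
  have "F = fps_of_poly p / fps_of_poly q \<longleftrightarrow> F * fps_of_poly q = fps_of_poly p"
    if "coeff q 0 \<noteq> 0" for p q :: "'a poly"
  proof -
    have q: "fps_nth (fps_of_poly q) 0 \<noteq> 0" using that by simp
    have "inverse (fps_of_poly q) * fps_of_poly q = 1" using q by (rule inverse_mult_eq_1)
    then have "x * inverse (fps_of_poly q) * fps_of_poly q = x"
      "x * fps_of_poly q * inverse (fps_of_poly q) = x" for x
      by (simp_all add: mult.assoc mult.commute[of "fps_of_poly q"])
    then show ?thesis unfolding fps_divide_unit[OF q] by metis
  qed
  then show ?thesis unfolding rational_fps_def by blast
qed

lemma rational_fps_of_poly: "rational_fps (fps_of_poly p)"
  unfolding rational_fps_iff by (rule exI[of _ p], rule exI[of _ 1]) simp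

lemma rational_fps_add:
  assumes "rational_fps F" "rational_fps G"
  shows "rational_fps (F + G)"
proof -
  obtain p q p' q' where "coeff q 0 \<noteq> 0" "F * fps_of_poly q = fps_of_poly p"
    "coeff q' 0 \<noteq> 0" "G * fps_of_poly q' = fps_of_poly p'"
    using assms unfolding rational_fps_iff by blast
  then have "coeff (q * q') 0 \<noteq> 0"
    "(F + G) * fps_of_poly (q * q') = fps_of_poly (p * q' + p' * q)"
    by (auto simp: fps_of_poly_mult fps_of_poly_add coeff_mult_0 algebra_simps)
  then show ?thesis unfolding rational_fps_iff by blast
qed

lemma rational_fps_mult:
  assumes "rational_fps F" "rational_fps G"
  shows "rational_fps (F * G)"
proof -
  obtain p q p' q' where h: "coeff q 0 \<noteq> 0" "F * fps_of_poly q = fps_of_poly p"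
    "coeff q' 0 \<noteq> 0" "G * fps_of_poly q' = fps_of_poly p'"
    using assms unfolding rational_fps_iff by blast
  have "(F * G) * fps_of_poly (q * q') = (F * fps_of_poly q) * (G * fps_of_poly q')"
    by (simp add: fps_of_poly_mult ac_simps)
  then have "(F * G) * fps_of_poly (q * q') = fps_of_poly (p * p')"
    using h by (simp add: fps_of_poly_mult)
  moreover have "coeff (q * q') 0 \<noteq> 0" using h by (simp add: coeff_mult_0)
  ultimately show ?thesis unfolding rational_fps_iff by blast
qed

lemma rational_fps_inverse:
  assumes "rational_fps F" "fps_nth F 0 \<noteq> 0"
  shows "rational_fps (inverse F)"
proof -
  obtain p q where h: "coeff q 0 \<noteq> 0" "F * fps_of_poly q = fps_of_poly p"
    using assms unfolding rational_fps_iff by blast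
  have "coeff p 0 = fps_nth F 0 * coeff q 0"
    using arg_cong[OF h(2), of "\<lambda>f. fps_nth f 0"] by simp
  moreover have "inverse F * fps_of_poly p = fps_of_poly q"
    using inverse_mult_eq_1[OF assms(2)] h(2) by (metis mult.assoc mult_1)
  ultimately show ?thesis
    using assms(2) h(1) unfolding rational_fps_iff by (metis mult_eq_0_iff)
qed

lemma rational_fps_const: "rational_fps (fps_const c)"
  using rational_fps_of_poly[of "[:c:]"] by (simp add: fps_of_poly_pCons)

lemma rational_fps_X: "rational_fps fps_X"
  using rational_fps_of_poly[of "[:0, 1:]"] by (simp add: fps_of_poly_pCons)

lemma rational_fps_diff:
  assumes "rational_fps F" "rational_fps G"
  shows "rational_fps (F - G)"
proof -
  have "F - G = F + fps_const (-1) * G"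
    by (simp flip: fps_const_neg)
  then show ?thesis
    using assms by (simp only: rational_fps_add rational_fps_mult rational_fps_const)
qed

lemma rational_fps_sum:
  assumes "finite S" "\<And>s. s \<in> S \<Longrightarrow> rational_fps (f s)"
  shows "rational_fps (\<Sum>s\<in>S. f s)"
  using assms
proof (induction S)
  case empty
  show ?case using rational_fps_const[of 0] by simp
qed (simp add: rational_fps_add)

text \<open>A series is recovered from its shift by multiplying with a power of \<open>fps_X\<close>
  and adding a polynomial, so finitely many initial coefficients do not affect rationality.\<close>

lemma rational_fps_of_shift:
  assumes "rational_fps (fps_shift n F)"
  shows "rational_fps F"
  using assms
proof (induction n arbitrary: F)
  case (Suc n)
  have eq: "F = fps_const (fps_nth F 0) + fps_X * fps_shift 1 F"
    by (rule fps_ext) simp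
  have "fps_shift n (fps_shift 1 F) = fps_shift (Suc n) F"
    by (rule fps_ext) simp
  then have "rational_fps (fps_shift 1 F)"
    using Suc.IH[of "fps_shift 1 F"] Suc.prems by simp
  then have "rational_fps (fps_const (fps_nth F 0) + fps_X * fps_shift 1 F)"
    by (intro rational_fps_add rational_fps_mult rational_fps_const rational_fps_X)
  then show ?case by (simp only: eq[symmetric])
qed simp

text \<open>Gaussian elimination: the pivots \<open>1 - A u u\<close> are units because the constant terms of the
  matrix vanish, a property that every elimination step preserves.\<close>

lemma rational_fps_linear_system:
  fixes G :: "'s \<Rightarrow> 'a::field fps"
  assumes "finite S"
    and "\<And>s. s \<in> S \<Longrightarrow> G s = b s + (\<Sum>t\<in>S. A s t * G t)"
    and "\<And>s. s \<in> S \<Longrightarrow> rational_fps (b s)"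
    and "\<And>s t. s \<in> S \<Longrightarrow> t \<in> S \<Longrightarrow> rational_fps (A s t) \<and> fps_nth (A s t) 0 = 0"
    and "s \<in> S"
  shows "rational_fps (G s)"
  using assms
proof (induction S arbitrary: A b s)
  case (insert u S)
  define c where "c = inverse (1 - A u u)"
  have A: "rational_fps (A s t)" "fps_nth (A s t) 0 = 0" if "s \<in> insert u S" "t \<in> insert u S" for s t
    using insert.prems(3)[OF that] by auto
  have b: "rational_fps (b s)" if "s \<in> insert u S" for s
    using insert.prems(2)[OF that] .
  have unit: "fps_nth (1 - A u u) 0 \<noteq> 0" using A by simp
  have rc: "rational_fps c"
    unfolding c_def using rational_fps_const[of 1] A
    by (intro rational_fps_inverse rational_fps_diff unit) auto
  \<comment> \<open>Row \<open>u\<close> is solved for \<open>G u\<close> by dividing by its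
    pivot.\<close>
  have Gu: "G u = c * b u + (\<Sum>t\<in>S. c * A u t * G t)"
  proof -
    have "G u = b u + (A u u * G u + (\<Sum>t\<in>S. A u t * G t))"
      using insert.prems(1)[of u] insert.hyps by simp
    then have "(1 - A u u) * G u = b u + (\<Sum>t\<in>S. A u t * G t)"
      by (simp add: algebra_simps)
    then have "c * ((1 - A u u) * G u) = c * b u + (\<Sum>t\<in>S. c * A u t * G t)"
      by (simp only: distrib_left sum_distrib_left mult.assoc)
    moreover have "c * (1 - A u u) = 1"
      unfolding c_def by (rule inverse_mult_eq_1[OF unit])
    ultimately show ?thesis by (simp flip: mult.assoc)
  qed
  \<comment> \<open>Substituting \<open>Gu\<close> removes the unknown \<open>G u\<close> from the
    other rows and leaves a system indexed by \<open>S\<close> alone, to which the induction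
    hypothesis applies.\<close>
  have "G s = (b s + A s u * (c * b u)) + (\<Sum>t\<in>S. (A s t + A s u * (c * A u t)) * G t)"
    if "s \<in> S" for s
  proof -
    have "G s = b s + (A s u * G u + (\<Sum>t\<in>S. A s t * G t))"
      using insert.prems(1)[of s] insert.hyps that by simp
    also have "A s u * G u = A s u * (c * b u) + (\<Sum>t\<in>S. A s u * (c * A u t) * G t)"
      by (subst Gu) (simp add: distrib_left sum_distrib_left mult.assoc)
    finally show ?thesis by (simp add: distrib_right sum.distrib)
  qed
  then have rat: "rational_fps (G s)" if "s \<in> S" for s
    by (rule insert.IH[where b = "\<lambda>s. b s + A s u * (c * b u)"
          and A = "\<lambda>s t. A s t + A s u * (c * A u t)"])
      (use that A b rc in \<open>auto intro!: rational_fps_add rational_fps_mult\<close>)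
  have "rational_fps (G u)"
    by (subst Gu) (use rat A b rc insert.hyps in
        \<open>auto intro!: rational_fps_add rational_fps_mult rational_fps_sum\<close>)
  then show ?case using rat insert.prems(4) by blast
qed simp

section \<open>Order isomorphism and patterns\<close>

lemma order_isomorphic_refl: "order_isomorphic v v"
  by (simp add: order_isomorphic_def)

lemma order_isomorphic_sym: "order_isomorphic v w \<Longrightarrow> order_isomorphic w v"
  by (simp add: order_isomorphic_def)

lemma order_isomorphic_trans [trans]:
  "order_isomorphic u v \<Longrightarrow> order_isomorphic v w \<Longrightarrow> order_isomorphic u w"
  by (simp add: order_isomorphic_def)

lemma order_isomorphic_nth:
  "order_isomorphic v w \<Longrightarrow> i < length v \<Longrightarrow> j < length v \<Longrightarrow> v ! i < v ! j \<longleftrightarrow> w ! i < w ! j"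
  by (simp add: order_isomorphic_def)

lemma order_isomorphic_drop: "order_isomorphic v w \<Longrightarrow> order_isomorphic (drop m v) (drop m w)"
  by (auto simp: order_isomorphic_def)

lemma order_isomorphic_butlast: "order_isomorphic v w \<Longrightarrow> order_isomorphic (butlast v) (butlast w)"
  by (auto simp: order_isomorphic_def nth_butlast)

lemma distinct_perms: "w \<in> perms n \<Longrightarrow> distinct w"
  by (simp add: permutations_of_set_def)

lemma length_perms: "w \<in> perms n \<Longrightarrow> length w = n"
  using distinct_card[of w] by (simp add: permutations_of_set_def)

lemma pattern_of_eq_iff:
  assumes "distinct v" "distinct w"
  shows "pattern_of v = pattern_of w \<longleftrightarrow> order_isomorphic v w"
  using pattern_of_eqI[OF assms] pattern_of(2)[OF assms(1)] pattern_of(2)[OF assms(2)]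
  by (metis order_isomorphic_sym order_isomorphic_trans)

lemma perms_eqI:
  assumes "v \<in> perms n" "w \<in> perms n" "order_isomorphic v w"
  shows "v = w"
  using assms ex1_pattern[of v] length_perms[OF assms(1)] order_isomorphic_refl distinct_perms
  by metis

lemma pattern_of_eq_perm_iff:
  assumes "distinct v" "w \<in> perms (length v)"
  shows "pattern_of v = w \<longleftrightarrow> order_isomorphic v w"
  using assms pattern_of[OF assms(1)] perms_eqI[of "pattern_of v" "length v" w]
  by (metis order_isomorphic_sym order_isomorphic_trans)

lemma distinct_nth_less_or_greater:
  fixes w :: "nat list"
  assumes "distinct w" "i < length w" "j < length w" "i \<noteq> j"
  shows "w ! i < w ! j \<or> w ! j < w ! i"
  using assms by (metis linorder_neqE_nat nth_eq_iff_index_eq)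

section \<open>Words whose value-adjacent entries are close\<close>

text \<open>For a permutation this means consecutive values. Only the relative order is mentioned,
  so the notion also applies to factors, whose values may have gaps, and is invariant under order
  isomorphism.\<close>

definition value_adjacent :: "nat list \<Rightarrow> nat \<Rightarrow> nat \<Rightarrow> bool" where
  "value_adjacent w i j \<longleftrightarrow> i < length w \<and> j < length w \<and> w ! i < w ! j \<and>
     (\<forall>l<length w. \<not> (w ! i < w ! l \<and> w ! l < w ! j))"

text \<open>The two inequalities bound the distance of \<open>i\<close> and \<open>j\<close> below
  \<open>k\<close> without truncated subtraction.\<close>

definition tight :: "nat \<Rightarrow> nat list \<Rightarrow> bool" where
  "tight k w \<longleftrightarrow> (\<forall>i j. value_adjacent w i j \<longrightarrow> i < j + k \<and> j < i + k)"

lemma tightD: "tight k w \<Longrightarrow> value_adjacent w i j \<Longrightarrow> i < j + k \<and> j < i + k"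
  by (simp add: tight_def)

lemma value_adjacent_order_isomorphic:
  "order_isomorphic v w \<Longrightarrow> value_adjacent v i j \<longleftrightarrow> value_adjacent w i j"
  unfolding value_adjacent_def order_isomorphic_def by auto

lemma tight_order_isomorphic: "order_isomorphic v w \<Longrightarrow> tight k v \<longleftrightarrow> tight k w"
  by (simp add: tight_def value_adjacent_order_isomorphic)

lemma value_adjacent_above:
  assumes "i < length w" "j < length w" "w ! i < w ! j"
  obtains l where "value_adjacent w i l" "w ! l \<le> w ! j"
proof -
  let ?P = "\<lambda>l. l < length w \<and> w ! i < w ! l"
  have "?P j" using assms by simp
  then obtain l where l: "?P l" "\<And>l'. ?P l' \<Longrightarrow> w ! l \<le> w ! l'"
    using ex_has_least_nat[of ?P j "(!) w"] by blast
  then have "value_adjacent w i l"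
    using assms(1) by (auto simp: value_adjacent_def simp flip: linorder_not_less)
  then show ?thesis using l(2)[OF \<open>?P j\<close>] by (rule that)
qed

text \<open>Climbing in value order from \<open>i\<close> to \<open>j\<close> by jumps shorter than \<open>k\<close>, one must land strictly
  between \<open>i\<close> and \<open>j\<close> if these are at distance at least \<open>k\<close>.\<close>

lemma tight_lands_between:
  assumes t: "tight k w" and dist: "distinct w"
    and ij: "i < length w" "j < length w" "w ! i < w ! j" and far: "i + k \<le> j \<or> j + k \<le> i"
  obtains l where "min i j < l" "l < max i j" "w ! i < w ! l" "w ! l < w ! j"
proof -
  \<comment> \<open>The part of the climb on the side of \<open>i\<close> away from
    \<open>j\<close>. From its highest entry \<open>l\<close>, the next jump, to \<open>l'\<close>,
    must leave this side, yet is too short to reach \<open>j\<close>.\<close>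
  let ?P = "\<lambda>l. l < length w \<and> w ! i \<le> w ! l \<and> w ! l < w ! j \<and> (if i < j then l \<le> i else i \<le> l)"
  have "?P i" using ij by simp
  moreover have "\<forall>l. ?P l \<longrightarrow> w ! l < Suc (w ! j)" by simp
  ultimately obtain l where l: "?P l" "\<And>l'. ?P l' \<Longrightarrow> w ! l' \<le> w ! l"
    using ex_has_greatest_nat[of ?P i "(!) w" "Suc (w ! j)"] by blast
  obtain l' where l': "value_adjacent w l l'" "w ! l' \<le> w ! j"
    using value_adjacent_above[of l w j] l(1) ij(2) by blast
  have d: "l < l' + k" "l' < l + k" using tightD[OF t l'(1)] by simp_all
  have v: "l' < length w" "w ! l < w ! l'" using l'(1) by (auto simp: value_adjacent_def)
  have neq: "i \<noteq> j" using ij(3) by auto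
  have inner: "if i < j then l' < j else j < l'" using d far l(1) neq by (auto split: if_splits)
  show ?thesis
  proof (cases "w ! l' < w ! j")
    case True
    then have "\<not> ?P l'" using l(2)[of l'] v by auto
    then have "if i < j then i < l' else l' < i" using True v l(1) by (auto split: if_splits)
    then show ?thesis using inner True v l(1) neq by (intro that[of l']) (auto split: if_splits)
  next
    case False
    then have "w ! l' = w ! j" using l'(2) by simp
    then have "l' = j" using dist v(1) ij(2) by (simp add: nth_eq_iff_index_eq)
    then show ?thesis using inner by (simp split: if_splits)
  qed
qed


text \<open>Two far entries of the factor have, by \<open>tight_lands_between\<close>, an entry
  between them both in position and in value. Being between them in position, it belongs to the
  factor, so the two are not value-adjacent there.\<close>

lemma tight_factor:
  assumes t: "tight k w" and dist: "distinct w"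
  shows "tight k (take m (drop a w))"
  unfolding tight_def
proof (intro allI impI)
  let ?u = "take m (drop a w)"
  fix i j assume adj: "value_adjacent ?u i j"
  have nth: "a + l < length w" "?u ! l = w ! (a + l)" if "l < length ?u" for l
    using that by auto
  have ij: "i < length ?u" "j < length ?u" "?u ! i < ?u ! j"
    using adj by (simp_all only: value_adjacent_def)
  show "i < j + k \<and> j < i + k"
  proof (rule ccontr)
    assume "\<not> (i < j + k \<and> j < i + k)"
    then have "a + i + k \<le> a + j \<or> a + j + k \<le> a + i" by auto
    then obtain l where l: "min (a + i) (a + j) < l" "l < max (a + i) (a + j)"
      "w ! (a + i) < w ! l" "w ! l < w ! (a + j)"
      using tight_lands_between[OF t dist nth(1)[OF ij(1)] nth(1)[OF ij(2)]] ij nth(2) by metis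
    then obtain l' where "l = a + l'" "l' < length ?u"
      using ij that by (intro that[of "l - a"]) auto
    then show False using adj l nth(2) ij by (auto simp: value_adjacent_def)
  qed
qed

lemma tight_butlast: "tight k w \<Longrightarrow> distinct w \<Longrightarrow> tight k (butlast w)"
  using tight_factor[of k w "length w - 1" 0] by (simp add: butlast_conv_take)

lemma tight_tl: "tight k w \<Longrightarrow> distinct w \<Longrightarrow> tight k (tl w)"
  using tight_factor[of k w "length w" 1] by (simp add: drop_Suc)

lemma value_adjacent_butlast:
  assumes "i < length w - 1" "j < length w - 1" "w ! i < w ! j"
    "\<And>l. l < length w - 1 \<Longrightarrow> \<not> (w ! i < w ! l \<and> w ! l < w ! j)"
  shows "value_adjacent (butlast w) i j"
  using assms by (simp add: value_adjacent_def nth_butlast)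

lemma value_adjacent_tl:
  assumes "0 < i" "0 < j" "i < length w" "j < length w" "w ! i < w ! j"
    "\<And>l. 0 < l \<Longrightarrow> l < length w \<Longrightarrow> \<not> (w ! i < w ! l \<and> w ! l < w ! j)"
  shows "value_adjacent (tl w) (i - 1) (j - 1)"
  using assms by (auto simp: value_adjacent_def nth_tl)

text \<open>If the two ends of \<open>w\<close> are value-adjacent, then they share their next larger and their next
  smaller inner entry. One of these exists, and is close to both ends, so \<open>w\<close> is short.\<close>

lemma tight_extend:
  assumes b: "tight k (butlast w)" and t: "tight k (tl w)" and dist: "distinct w"
    and len: "2 * k < length w" and k: "1 \<le> k"
  shows "tight k w"
  unfolding tight_def
proof (intro allI impI)
  fix i j assume adj: "value_adjacent w i j"
  define n where "n = length w - 1"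
  have lw: "length w = Suc n" using len by (simp add: n_def)
  have ij: "i \<le> n" "j \<le> n" "w ! i < w ! j" and
    no: "\<And>l. l \<le> n \<Longrightarrow> \<not> (w ! i < w ! l \<and> w ! l < w ! j)"
    using adj lw by (auto simp: value_adjacent_def)
  have B: "x < y + k \<and> y < x + k"
    if "x < n" "y < n" "w ! x < w ! y" "\<And>l. l < n \<Longrightarrow> \<not> (w ! x < w ! l \<and> w ! l < w ! y)" for x y
    using tightD[OF b value_adjacent_butlast] that lw by auto
  have T: "x < y + k \<and> y < x + k"
    if "0 < x" "x \<le> n" "0 < y" "y \<le> n" "w ! x < w ! y"
      "\<And>l. 0 < l \<Longrightarrow> l \<le> n \<Longrightarrow> \<not> (w ! x < w ! l \<and> w ! l < w ! y)" for x y
    using tightD[OF t value_adjacent_tl, of x y] that lw by auto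
  show "i < j + k \<and> j < i + k"
  proof (cases "(i < n \<and> j < n) \<or> (0 < i \<and> 0 < j)")
    case True
    then show ?thesis using B[of i j] T[of i j] ij no by auto
  next
    case False
    \<comment> \<open>The two ends form the only pair contained in neither \<open>butlast w\<close>
      nor \<open>tl w\<close>.\<close>
    then have ends: "(i = 0 \<and> j = n) \<or> (i = n \<and> j = 0)" using ij lw len k by auto
    have sides: "w ! l < w ! 0 \<and> w ! l < w ! n \<or> w ! 0 < w ! l \<and> w ! n < w ! l"
      if "0 < l" "l < n" for l
      using distinct_nth_less_or_greater[OF dist, of l 0] distinct_nth_less_or_greater[OF dist, of l n]
        no[of l] ij(3) ends lw that by auto
    have n1: "0 < (1::nat)" "1 < n" using lw len k by auto
    have "n < 2 * k"
    proof (cases "w ! 0 < w ! 1")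
      case True
      let ?P = "\<lambda>l. 0 < l \<and> l < n \<and> w ! 0 < w ! l"
      have "?P 1" using n1 True by simp
      then obtain l where l: "?P l" "\<And>m. ?P m \<Longrightarrow> w ! l \<le> w ! m"
        using ex_has_least_nat[of ?P 1 "(!) w"] by blast
      have "\<not> (w ! 0 < w ! m \<and> w ! m < w ! l)" if "m < n" for m
        using l(2)[of m] that by (cases "m = 0") auto
      moreover have "\<not> (w ! n < w ! m \<and> w ! m < w ! l)" if "0 < m" "m \<le> n" for m
        using l(2)[of m] sides[of m] that by (cases "m = n") auto
      \<comment> \<open>\<open>l\<close> is value-adjacent to the first entry within
        \<open>butlast w\<close> and to the last entry within \<open>tl w\<close>. Hence
        \<open>l < k\<close> and \<open>n < l + k\<close>.\<close>
      ultimately show ?thesis using B[of 0 l] T[of n l] l(1) sides[of l] by auto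
    next
      case False
      let ?P = "\<lambda>l. 0 < l \<and> l < n \<and> w ! l < w ! 0"
      have "?P 1" using n1 False sides[of 1] by simp
      moreover have "\<forall>l. ?P l \<longrightarrow> w ! l < w ! 0" by simp
      ultimately obtain l where l: "?P l" "\<And>m. ?P m \<Longrightarrow> w ! m \<le> w ! l"
        using ex_has_greatest_nat[of ?P 1 "(!) w" "w ! 0"] by blast
      have "\<not> (w ! l < w ! m \<and> w ! m < w ! 0)" if "m < n" for m
        using l(2)[of m] that by (cases "m = 0") auto
      moreover have "\<not> (w ! l < w ! m \<and> w ! m < w ! n)" if "0 < m" "m \<le> n" for m
        using l(2)[of m] sides[of m] that by (cases "m = n") auto
      ultimately show ?thesis using B[of l 0] T[of l n] l(1) sides[of l] by auto
    qed
    then show ?thesis using lw len by simp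
  qed
qed

text \<open>First entries are peeled off until only \<open>m\<close> remain;
  \<open>tight_extend\<close> then restores them one at a time. So after appending an entry, only
  the last \<open>m\<close> entries need checking.\<close>

lemma tight_extend_suffix:
  assumes "tight k (butlast w)" "tight k (drop (length w - m) w)" "distinct w"
    and "2 * k < m" "m \<le> length w" "1 \<le> k"
  shows "tight k w"
  using assms
proof (induction "length w" arbitrary: w rule: less_induct)
  case less
  show ?case
  proof (cases "length w = m")
    case True
    then show ?thesis using less.prems by simp
  next
    case False
    have "tight k (tl w)"
    proof (rule less.hyps)
      show "tight k (butlast (tl w))"
        using tight_tl[OF less.prems(1)] less.prems(3) by (simp add: butlast_tl distinct_butlast)
      show "tight k (drop (length (tl w) - m) (tl w))"
        using less.prems False by (simp add: drop_Suc[symmetric] Suc_diff_Suc Suc_diff_le)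
    qed (use less.prems False in \<open>auto simp: distinct_tl\<close>)
    then show ?thesis using tight_extend less.prems by auto
  qed
qed

section \<open>Unique determination\<close>

text \<open>Induction on the difference of the two values in \<open>v\<close>: a pair that is not
  value-adjacent splits at an intermediate value. Preserving \<open><\<close> in one direction
  suffices, since distinct entries of \<open>v\<close> are always comparable.\<close>

lemma tight_determines_order:
  assumes t: "tight k v" and dist: "distinct v" and len: "length w = length v"
    and local: "\<And>i j. i < length v \<Longrightarrow> j < length v \<Longrightarrow> i < j + k \<Longrightarrow> j < i + k \<Longrightarrow>
      v ! i < v ! j \<Longrightarrow> w ! i < w ! j"
  shows "order_isomorphic v w"
proof -
  have mono: "w ! i < w ! j" if "i < length v" "j < length v" "v ! i < v ! j" for i j
    using that
  proof (induction "v ! j - v ! i" arbitrary: i j rule: less_induct)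
    case less
    show ?case
    proof (cases "value_adjacent v i j")
      case True
      then show ?thesis using tightD[OF t True] local less.prems by blast
    next
      case False
      then obtain l where "l < length v" "v ! i < v ! l" "v ! l < v ! j"
        using less.prems by (auto simp: value_adjacent_def)
      then show ?thesis
        using less.hyps[of l i] less.hyps[of j l] less.prems
        by (meson diff_less_mono diff_less_mono2 less_imp_le less_trans)
    qed
  qed
  show ?thesis unfolding order_isomorphic_def
    using mono distinct_nth_less_or_greater[OF dist] len by (metis less_asym less_irrefl)
qed

text \<open>The window starts at the smaller position, or at \<open>n - k\<close> if it would
  otherwise run past the end.\<close>

lemma common_window:
  fixes i j k n :: nat
  assumes "i < n" "j < n" "i < j + k" "j < i + k" "k \<le> n"
  obtains a x y where "a + k \<le> n" "x < k" "y < k" "i = a + x" "j = a + y"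
proof
  let ?a = "min (min i j) (n - k)"
  show "?a + k \<le> n" "i - ?a < k" "j - ?a < k" "i = ?a + (i - ?a)" "j = ?a + (j - ?a)"
    using assms by (auto simp: min_def)
qed

lemma overlap_path_eq_iff:
  assumes "\<pi> \<in> perms n" "\<sigma> \<in> perms n" "k \<le> n"
  shows "overlap_path k \<sigma> = overlap_path k \<pi> \<longleftrightarrow>
    (\<forall>a. a + k \<le> n \<longrightarrow> order_isomorphic (take k (drop a \<sigma>)) (take k (drop a \<pi>)))"
proof -
  have "distinct \<pi>" "distinct \<sigma>" using assms by (simp_all add: permutations_of_set_def)
  then show ?thesis
    using assms length_perms[OF assms(1)] length_perms[OF assms(2)]
    by (auto simp: overlap_path_def pattern_of_eq_iff simp del: upt_Suc)
qed

lemma swap_nth: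
  fixes w :: "'a list"
  assumes "i < length w" "j < length w" "x < length w"
  shows "w[i := w ! j, j := w ! i] ! x = (if x = i then w ! j else if x = j then w ! i else w ! x)"
  using assms by (auto simp: nth_list_update)

text \<open>The case \<open>n < k\<close> fits without exception: all positions are then at distance
  less than \<open>k\<close>, so every permutation is tight, in accordance with the
  convention.\<close>

lemma uniquely_determined_iff_tight:
  assumes k: "1 \<le> k"
  shows "uniquely_determined k n \<pi> \<longleftrightarrow> \<pi> \<in> perms n \<and> tight k \<pi>"
proof (cases "\<pi> \<in> perms n")
  case False
  then show ?thesis by (simp add: uniquely_determined_def)
next
  case perm: True
  have len: "length \<pi> = n" and dist: "distinct \<pi>"
    using perm by (simp_all add: length_perms permutations_of_set_def)
  have "\<sigma> = \<pi>" if t: "tight k \<pi>" and kn: "k \<le> n" and \<sigma>: "\<sigma> \<in> perms n"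
    and path: "overlap_path k \<sigma> = overlap_path k \<pi>" for \<sigma>
  proof -
    have "order_isomorphic \<pi> \<sigma>"
    proof (rule tight_determines_order[OF t dist])
      show ls: "length \<sigma> = length \<pi>" using length_perms[OF \<sigma>] len by simp
      fix i j assume ij: "i < length \<pi>" "j < length \<pi>" "i < j + k" "j < i + k" "\<pi> ! i < \<pi> ! j"
      then obtain a x y where a: "a + k \<le> n" "x < k" "y < k" "i = a + x" "j = a + y"
        using common_window[of i n j k] kn len by blast
      then have "order_isomorphic (take k (drop a \<sigma>)) (take k (drop a \<pi>))"
        using path overlap_path_eq_iff[OF perm \<sigma> kn] by blast
      from order_isomorphic_nth[OF this, of x y] show "\<sigma> ! i < \<sigma> ! j"
        using a ij(5) ls len by simp
    qed
    then show ?thesis using perms_eqI perm \<sigma> by blast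
  qed
  moreover have "\<exists>\<sigma>\<in>perms n. \<sigma> \<noteq> \<pi> \<and> overlap_path k \<sigma> = overlap_path k \<pi>" "k \<le> n"
    if "\<not> tight k \<pi>"
  proof -
    from that obtain i j where adj: "value_adjacent \<pi> i j" and far: "i + k \<le> j \<or> j + k \<le> i"
      by (auto simp: tight_def linorder_not_less)
    then have ij: "i < n" "j < n" "\<pi> ! i < \<pi> ! j"
      and no: "\<And>l. l < n \<Longrightarrow> \<not> (\<pi> ! i < \<pi> ! l \<and> \<pi> ! l < \<pi> ! j)"
      using len by (auto simp: value_adjacent_def)
    show kn: "k \<le> n" using ij far by auto
    \<comment> \<open>The competitor with the same path: the two value-adjacent entries are
      exchanged. No value lies between them, so their comparisons with all other entries are
      unchanged.\<close>
    define \<sigma> where "\<sigma> = \<pi>[i := \<pi> ! j, j := \<pi> ! i]"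
    have nth: "\<sigma> ! x = (if x = i then \<pi> ! j else if x = j then \<pi> ! i else \<pi> ! x)" if "x < n" for x
      using swap_nth[of i \<pi> j x] ij len that unfolding \<sigma>_def by simp
    have ls: "length \<sigma> = n" using len by (simp add: \<sigma>_def)
    have perm\<sigma>: "\<sigma> \<in> perms n"
      using perm ij len unfolding permutations_of_set_def \<sigma>_def by (simp add: set_swap)
    have neq: "\<sigma> \<noteq> \<pi>" using nth[of i] ij by auto
    have same: "\<pi> ! i < \<pi> ! x \<longleftrightarrow> \<pi> ! j < \<pi> ! x" "\<pi> ! x < \<pi> ! i \<longleftrightarrow> \<pi> ! x < \<pi> ! j"
      if "x < n" "x \<noteq> i" "x \<noteq> j" for x
      using no[of x] ij that distinct_nth_less_or_greater[OF dist, of x i]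
        distinct_nth_less_or_greater[OF dist, of x j] len by auto
    have order: "\<sigma> ! p < \<sigma> ! q \<longleftrightarrow> \<pi> ! p < \<pi> ! q"
      if "p < n" "q < n" "\<not> (p = i \<and> q = j)" "\<not> (p = j \<and> q = i)" for p q
      using that by (metis nth same less_irrefl)
    have "order_isomorphic (take k (drop a \<sigma>)) (take k (drop a \<pi>))" if a: "a + k \<le> n" for a
    proof -
      \<comment> \<open>A window of length \<open>k\<close> cannot contain both \<open>i\<close> and
        \<open>j\<close>, the only two positions whose mutual order is reversed.\<close>
      have "\<sigma> ! (a + x) < \<sigma> ! (a + y) \<longleftrightarrow> \<pi> ! (a + x) < \<pi> ! (a + y)" if "x < k" "y < k" for x y
        by (rule order) (use far a that in linarith)+
      then show ?thesis using a ls len by (simp add: order_isomorphic_def)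
    qed
    then show "\<exists>\<sigma>\<in>perms n. \<sigma> \<noteq> \<pi> \<and> overlap_path k \<sigma> = overlap_path k \<pi>"
      using overlap_path_eq_iff[OF perm perm\<sigma> kn] perm\<sigma> neq by blast
  qed
  ultimately show ?thesis using perm by (auto simp: uniquely_determined_def)
qed

section \<open>Extending a tight permutation on the right\<close>

definition tight_perms :: "nat \<Rightarrow> nat \<Rightarrow> nat list set" where
  "tight_perms k n = {\<pi> \<in> perms n. tight k \<pi>}"

text \<open>These patterns are the states of the transfer matrix. The definition is applied to words
  of length at least \<open>m\<close>.\<close>

definition last_pattern :: "nat \<Rightarrow> nat list \<Rightarrow> nat list" where
  "last_pattern m w = pattern_of (drop (length w - m) w)"

lemma finite_tight_perms: "finite (tight_perms k n)"
  by (simp add: tight_perms_def)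

lemma last_pattern:
  assumes "distinct w" "m \<le> length w"
  shows "last_pattern m w \<in> perms m" "order_isomorphic (drop (length w - m) w) (last_pattern m w)"
  using assms pattern_of[of "drop (length w - m) w"] by (simp_all add: last_pattern_def)

lemma last_pattern_eq_iff:
  assumes "distinct w" "m \<le> length w" "s \<in> perms m"
  shows "last_pattern m w = s \<longleftrightarrow> order_isomorphic (drop (length w - m) w) s"
  unfolding last_pattern_def using assms by (intro pattern_of_eq_perm_iff) simp_all

lemma last_pattern_tight:
  assumes "\<pi> \<in> tight_perms k n" "m \<le> n"
  shows "last_pattern m \<pi> \<in> tight_perms k m"
proof -
  have p: "distinct \<pi>" "length \<pi> = n" "tight k \<pi>"
    using assms length_perms by (auto simp: tight_perms_def permutations_of_set_def)
  then have "tight k (drop (n - m) \<pi>)" using tight_factor[of k \<pi> m "n - m"] by simp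
  then show ?thesis
    using last_pattern[of \<pi> m] p assms(2) tight_order_isomorphic by (auto simp: tight_perms_def)
qed

text \<open>Removing the first of the last \<open>m\<close> entries leaves the suffix of length
  \<open>m - 1\<close>. It starts at index \<open>Suc n - m\<close>, which is also where the last
  \<open>m\<close> entries of a one-entry extension start.\<close>

lemma last_pattern_overlap_arc_iff:
  assumes "\<rho> \<in> perms n" "m \<le> n" "1 \<le> m" "s \<in> perms m"
  shows "(last_pattern m \<rho>, s) \<in> overlap_arcs m \<longleftrightarrow>
    order_isomorphic (drop (Suc n - m) \<rho>) (butlast s)"
proof -
  have p: "distinct \<rho>" "length \<rho> = n" using assms length_perms by (auto simp: permutations_of_set_def)
  note l = last_pattern[of \<rho> m, unfolded p(2), OF p(1) assms(2)]
  have "distinct (tl (last_pattern m \<rho>))" "distinct (butlast s)"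
    using l(1) assms(4) by (auto simp: permutations_of_set_def distinct_tl distinct_butlast)
  then have "(last_pattern m \<rho>, s) \<in> overlap_arcs m \<longleftrightarrow>
      order_isomorphic (tl (last_pattern m \<rho>)) (butlast s)"
    using l(1) assms(4) by (simp add: overlap_arcs_def pattern_of_eq_iff)
  moreover have "order_isomorphic (drop (Suc n - m) \<rho>) (tl (last_pattern m \<rho>))"
    using order_isomorphic_drop[OF l(2), of 1] assms(2) by (simp add: drop_Suc Suc_diff_le)
  ultimately show ?thesis
    using order_isomorphic_sym order_isomorphic_trans by blast
qed

text \<open>The new entry goes directly above the largest entry of the suffix that \<open>s\<close>
  requires to be smaller than its last one.\<close>

lemma extend_by_last_entry:
  assumes \<rho>: "\<rho> \<in> perms n" and s: "s \<in> perms m" and m: "m \<le> n" "1 \<le> m"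
    and iso: "order_isomorphic (drop (Suc n - m) \<rho>) (butlast s)"
  obtains \<pi> where "\<pi> \<in> perms (Suc n)" "order_isomorphic (butlast \<pi>) \<rho>"
    "order_isomorphic (drop (Suc n - m) \<pi>) s"
proof -
  define a where "a = Suc n - m"
  define q where "q = m - 1"
  have mq: "m = Suc q" "n = a + q" using m by (simp_all add: q_def a_def)
  have len: "length \<rho> = n" "length s = Suc q" and dist: "distinct \<rho>" "distinct s"
    using \<rho> s length_perms mq by (auto simp: permutations_of_set_def)
  have less: "\<rho> ! (a + x) < \<rho> ! (a + y) \<longleftrightarrow> s ! x < s ! y" if "x < q" "y < q" for x y
    using order_isomorphic_nth[OF iso[folded a_def], of x y] that len mq by (simp add: nth_butlast)
  \<comment> \<open>The element \<open>0\<close>, below all entries of \<rho>, covers the case that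
    the new entry is to be smaller than the whole suffix.\<close>
  define C where "C = insert 0 ((\<lambda>x. \<rho> ! (a + x)) ` {x. x < q \<and> s ! x < s ! q})"
  define c where "c = Max C"
  have finC: "finite C" by (simp add: C_def)
  have cut: "\<rho> ! (a + x) \<le> c \<longleftrightarrow> s ! x < s ! q" if x: "x < q" for x
  proof
    assume "s ! x < s ! q"
    then have "\<rho> ! (a + x) \<in> C" using x by (simp add: C_def)
    then show "\<rho> ! (a + x) \<le> c" unfolding c_def using finC by simp
  next
    assume le: "\<rho> ! (a + x) \<le> c"
    have "\<rho> ! (a + x) \<in> set \<rho>" using x len mq by simp
    then have "0 < \<rho> ! (a + x)" using \<rho> by (auto simp: permutations_of_set_def)
    moreover have "c \<in> C" unfolding c_def using finC by (intro Max_in) (auto simp: C_def)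
    ultimately obtain y where y: "y < q" "s ! y < s ! q" "c = \<rho> ! (a + y)"
      using le by (auto simp: C_def)
    then have "\<not> s ! y < s ! x" using less[of y x] le x by simp
    then show "s ! x < s ! q" using y(2) by simp
  qed
  \<comment> \<open>Doubling the values makes room for \<open>2 * c + 1\<close> directly above
    \<open>2 * c\<close>; taking the pattern then restores the values to an initial segment.\<close>
  define u where "u = map (\<lambda>y. 2 * y) \<rho> @ [2 * c + 1]"
  have lu: "length u = Suc n" using len by (simp add: u_def)
  have "2 * c + 1 \<noteq> 2 * y" for y by presburger
  then have du: "distinct u" using dist by (auto simp: u_def distinct_map inj_on_def)
  have nth: "u ! (a + x) = (if x < q then 2 * \<rho> ! (a + x) else 2 * c + 1)" if "x \<le> q" for x
    using that len mq by (simp add: u_def nth_append)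
  have "order_isomorphic (drop a u) s"
    unfolding order_isomorphic_def
  proof (intro conjI allI impI)
    show "length (drop a u) = length s" using lu len mq by simp
    fix x y assume "x < length (drop a u)" "y < length (drop a u)"
    then have xy: "x \<le> q" "y \<le> q" using lu mq by auto
    have neq: "s ! x \<noteq> s ! q" if "x < q" for x
      using that len dist by (simp add: nth_eq_iff_index_eq)
    have "u ! (a + x) < u ! (a + y) \<longleftrightarrow> s ! x < s ! y"
      using xy nth[OF xy(1)] nth[OF xy(2)] less[of x y] cut[of x] cut[of y] neq[of x] neq[of y]
      by (cases "x = q"; cases "y = q") auto
    then show "drop a u ! x < drop a u ! y \<longleftrightarrow> s ! x < s ! y" using lu mq by simp
  qed
  moreover have "order_isomorphic (butlast u) \<rho>"
    by (simp add: u_def order_isomorphic_def)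
  moreover have "order_isomorphic (pattern_of u) u"
    using pattern_of(2)[OF du] by (rule order_isomorphic_sym)
  ultimately have "order_isomorphic (butlast (pattern_of u)) \<rho>"
    "order_isomorphic (drop (Suc n - m) (pattern_of u)) s"
    unfolding a_def[symmetric]
    using order_isomorphic_butlast order_isomorphic_drop order_isomorphic_trans by blast+
  with pattern_of(1)[OF du] lu that show ?thesis by simp
qed

text \<open>Deleting the last entry is injective because every pair at distance less than
  \<open>k\<close> lies in the first \<open>n\<close> or in the last \<open>m\<close> entries, and
  tightness makes such pairs decisive. It is surjective because the extension glued from \<rho> and
  \<open>s\<close> is tight by \<open>tight_extend_suffix\<close>.\<close>

lemma bij_betw_tight_extensions:
  assumes k: "1 \<le> k" and m: "2 * k < m" "m \<le> n" and s: "s \<in> tight_perms k m"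
  shows "bij_betw (\<lambda>\<pi>. pattern_of (butlast \<pi>))
    {\<pi> \<in> tight_perms k (Suc n). last_pattern m \<pi> = s}
    {\<rho> \<in> tight_perms k n. (last_pattern m \<rho>, s) \<in> overlap_arcs m}"
    (is "bij_betw ?f ?A ?B")
proof -
  define a where "a = Suc n - m"
  have sp: "s \<in> perms m" and ts: "tight k s" using s by (simp_all add: tight_perms_def)
  have A_iff: "\<pi> \<in> ?A \<longleftrightarrow> \<pi> \<in> perms (Suc n) \<and> tight k \<pi> \<and> order_isomorphic (drop a \<pi>) s" for \<pi>
    using last_pattern_eq_iff[of \<pi> m s] sp m length_perms[of \<pi> "Suc n"]
    by (auto simp: tight_perms_def a_def permutations_of_set_def)
  have B_iff: "\<rho> \<in> ?B \<longleftrightarrow>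
      \<rho> \<in> perms n \<and> tight k \<rho> \<and> order_isomorphic (drop a \<rho>) (butlast s)" for \<rho>
    using last_pattern_overlap_arc_iff[of \<rho> n m s] sp m by (auto simp: tight_perms_def a_def)
  have perm: "distinct \<pi>" "length \<pi> = Suc n" if "\<pi> \<in> perms (Suc n)" for \<pi>
    using that length_perms by (auto simp: permutations_of_set_def)
  have pattern: "?f \<pi> \<in> perms n" "order_isomorphic (butlast \<pi>) (?f \<pi>)" if "\<pi> \<in> perms (Suc n)" for \<pi>
    using pattern_of[of "butlast \<pi>"] perm[OF that] by (simp_all add: distinct_butlast)
  have "?f \<pi> \<in> ?B" if "\<pi> \<in> ?A" for \<pi>
  proof -
    have \<pi>: "\<pi> \<in> perms (Suc n)" "tight k \<pi>" "order_isomorphic (drop a \<pi>) s"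
      using that A_iff by blast+
    have "tight k (?f \<pi>)"
      using tight_butlast[OF \<pi>(2)] perm[OF \<pi>(1)] pattern(2)[OF \<pi>(1)] tight_order_isomorphic by blast
    moreover have "order_isomorphic (drop a (?f \<pi>)) (butlast s)"
      using order_isomorphic_butlast[OF \<pi>(3)] order_isomorphic_drop[OF pattern(2)[OF \<pi>(1)], of a]
      unfolding butlast_drop by (metis drop_butlast order_isomorphic_sym order_isomorphic_trans)
    ultimately show ?thesis using pattern(1)[OF \<pi>(1)] B_iff by blast
  qed
  moreover have "\<pi> = \<pi>'" if "\<pi> \<in> ?A" "\<pi>' \<in> ?A" "?f \<pi> = ?f \<pi>'" for \<pi> \<pi>'
  proof -
    have \<pi>: "\<pi> \<in> perms (Suc n)" "tight k \<pi>" "order_isomorphic (drop a \<pi>) s"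
      and \<pi>': "\<pi>' \<in> perms (Suc n)" "order_isomorphic (drop a \<pi>') s"
      using that(1,2) A_iff by blast+
    have eq_front: "order_isomorphic (butlast \<pi>) (butlast \<pi>')"
      using pattern(2)[OF \<pi>(1)] pattern(2)[OF \<pi>'(1)] that(3)
      by (metis order_isomorphic_sym order_isomorphic_trans)
    have eq_back: "order_isomorphic (drop a \<pi>) (drop a \<pi>')"
      using \<pi>(3) \<pi>'(2) order_isomorphic_sym order_isomorphic_trans by blast
    note len = perm(2)[OF \<pi>(1)] perm(2)[OF \<pi>'(1)]
    have "order_isomorphic \<pi> \<pi>'"
    proof (rule tight_determines_order[OF \<pi>(2) perm(1)[OF \<pi>(1)]])
      fix i j assume ij: "i < length \<pi>" "j < length \<pi>" "i < j + k" "j < i + k" "\<pi> ! i < \<pi> ! j"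
      show "\<pi>' ! i < \<pi>' ! j"
      proof (cases "i < n \<and> j < n")
        case True
        then show ?thesis using order_isomorphic_nth[OF eq_front, of i j] ij len by (simp add: nth_butlast)
      next
        case False
        \<comment> \<open>One of the positions is the last one, \<open>n\<close>, and the other is
          less than \<open>k\<close> away, so both fall in the final window of length
          \<open>m\<close>.\<close>
        then have "a \<le> i" "a \<le> j" using ij len m by (auto simp: a_def)
        then show ?thesis using order_isomorphic_nth[OF eq_back, of "i - a" "j - a"] ij len by simp
      qed
    qed (simp add: len)
    then show ?thesis using perms_eqI \<pi>(1) \<pi>'(1) by blast
  qed
  moreover have "\<exists>\<pi>\<in>?A. \<rho> = ?f \<pi>" if "\<rho> \<in> ?B" for \<rho>
  proof -
    have \<rho>: "\<rho> \<in> perms n" "tight k \<rho>" "order_isomorphic (drop a \<rho>) (butlast s)"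
      using that B_iff by blast+
    then obtain \<pi> where \<pi>: "\<pi> \<in> perms (Suc n)" "order_isomorphic (butlast \<pi>) \<rho>"
      "order_isomorphic (drop a \<pi>) s"
      using extend_by_last_entry[OF \<rho>(1) sp] m unfolding a_def by auto
    have "tight k \<pi>"
    proof (rule tight_extend_suffix)
      show "tight k (butlast \<pi>)" using \<pi>(2) \<rho>(2) tight_order_isomorphic by blast
      show "tight k (drop (length \<pi> - m) \<pi>)"
        using \<pi>(3) ts tight_order_isomorphic perm(2)[OF \<pi>(1)] unfolding a_def by auto
    qed (use perm[OF \<pi>(1)] m k in auto)
    then have "\<pi> \<in> ?A" using \<pi> A_iff by blast
    moreover have "\<rho> = ?f \<pi>"
      using pattern[OF \<pi>(1)] \<pi>(2) \<rho>(1) perms_eqI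
      by (metis order_isomorphic_sym order_isomorphic_trans)
    ultimately show ?thesis by blast
  qed
  ultimately show ?thesis by (intro bij_betwI') blast+
qed

section \<open>The transfer matrix\<close>

definition num_ending :: "nat \<Rightarrow> nat \<Rightarrow> nat \<Rightarrow> nat list \<Rightarrow> nat" where
  "num_ending k m n s = card {\<pi> \<in> tight_perms k n. last_pattern m \<pi> = s}"

text \<open>The predicate \<open>P\<close> allows two uses: selecting the states with an arc to a
  given one, and counting all tight permutations.\<close>

lemma card_tight_perms_by_ending:
  assumes "m \<le> n"
  shows "card {\<pi> \<in> tight_perms k n. P (last_pattern m \<pi>)} =
    (\<Sum>s\<in>tight_perms k m. if P s then num_ending k m n s else 0)"
proof -
  let ?Q = "{\<pi> \<in> tight_perms k n. P (last_pattern m \<pi>)}"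
  have "card ?Q = (\<Sum>s\<in>tight_perms k m. \<Sum>\<pi>\<in>{\<pi> \<in> ?Q. last_pattern m \<pi> = s}. 1)"
    unfolding card_eq_sum
    by (rule sum.group[symmetric]) (use finite_tight_perms last_pattern_tight assms in auto)
  also have "\<dots> = (\<Sum>s\<in>tight_perms k m. if P s then num_ending k m n s else 0)"
  proof (rule sum.cong)
    fix s
    have "{\<pi> \<in> ?Q. last_pattern m \<pi> = s} =
        (if P s then {\<pi> \<in> tight_perms k n. last_pattern m \<pi> = s} else {})"
      by auto
    then show "(\<Sum>\<pi>\<in>{\<pi> \<in> ?Q. last_pattern m \<pi> = s}. 1) = (if P s then num_ending k m n s else 0)"
      by (simp add: num_ending_def)
  qed simp
  finally show ?thesis .
qed

lemma num_ending_Suc: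
  assumes "1 \<le> k" "2 * k < m" "m \<le> n" "s \<in> tight_perms k m"
  shows "num_ending k m (Suc n) s =
    (\<Sum>t\<in>tight_perms k m. if (t, s) \<in> overlap_arcs m then num_ending k m n t else 0)"
  using bij_betw_same_card[OF bij_betw_tight_extensions[OF assms]]
    card_tight_perms_by_ending[OF assms(3), of k "\<lambda>t. (t, s) \<in> overlap_arcs m"]
  by (simp add: num_ending_def)

lemma num_uniquely_determined_eq:
  assumes "1 \<le> k" "m \<le> n"
  shows "num_uniquely_determined k n = (\<Sum>s\<in>tight_perms k m. num_ending k m n s)"
  using card_tight_perms_by_ending[OF assms(2), of k "\<lambda>_. True"]
  by (simp add: num_uniquely_determined_def uniquely_determined_iff_tight[OF assms(1)] tight_perms_def)

theorem theorem6:
  fixes k :: nat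
  assumes "k \<ge> 1"
  shows "rational_fps (gf_uniquely_determined k)"
proof -
  \<comment> \<open>The least \<open>m\<close> satisfying the condition \<open>2 * k < m\<close> of
    \<open>tight_extend_suffix\<close>.\<close>
  define m where "m = 2 * k + 1"
  define S where "S = tight_perms k m"
  define G :: "nat list \<Rightarrow> rat fps" where
    "G s = Abs_fps (\<lambda>n. of_nat (num_ending k m (n + m) s))" for s
  \<comment> \<open>The adjacency matrix times \<open>fps_X\<close>: one step adds one entry, and
    the constant terms vanish as the linear system requires.\<close>
  define A :: "nat list \<Rightarrow> nat list \<Rightarrow> rat fps" where
    "A s t = (if (t, s) \<in> overlap_arcs m then fps_X else 0)" for s t
  have fin: "finite S" by (simp add: S_def finite_tight_perms)
  have G: "fps_nth (G s) n = of_nat (num_ending k m (n + m) s)" for s n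
    by (simp add: G_def)
  have rec: "G s = fps_const (of_nat (num_ending k m m s)) + (\<Sum>t\<in>S. A s t * G t)" if "s \<in> S" for s
  proof (rule fps_ext)
    fix n
    show "fps_nth (G s) n =
        fps_nth (fps_const (of_nat (num_ending k m m s)) + (\<Sum>t\<in>S. A s t * G t)) n"
    proof (cases n)
      case 0
      then show ?thesis by (auto simp: fps_sum_nth A_def G intro!: sum.neutral)
    next
      case (Suc n')
      have A: "fps_nth (A s t * G t) (Suc n') =
          (if (t, s) \<in> overlap_arcs m then of_nat (num_ending k m (n' + m) t) else 0)" for t
        by (simp add: A_def G)
      have "num_ending k m (Suc (n' + m)) s =
          (\<Sum>t\<in>S. if (t, s) \<in> overlap_arcs m then num_ending k m (n' + m) t else 0)"
        unfolding S_def by (rule num_ending_Suc) (use assms that in \<open>auto simp: m_def S_def\<close>)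
      then have "of_nat (num_ending k m (Suc (n' + m)) s) =
          (\<Sum>t\<in>S. if (t, s) \<in> overlap_arcs m then of_nat (num_ending k m (n' + m) t) else (0 :: rat))"
        by (simp add: if_distrib[of of_nat] cong: if_cong)
      then show ?thesis using Suc by (simp add: fps_sum_nth A G)
    qed
  qed
  have "rational_fps (G s)" if "s \<in> S" for s
    by (rule rational_fps_linear_system[OF fin rec _ _ that])
      (use rational_fps_X rational_fps_const[of 0] in \<open>auto simp: A_def rational_fps_const\<close>)
  then have "rational_fps (\<Sum>s\<in>S. G s)" by (rule rational_fps_sum[OF fin])
  \<comment> \<open>Only lengths from \<open>m\<close> on have a state; the shift discards the
    shorter ones.\<close>
  moreover have "fps_shift m (gf_uniquely_determined k) = (\<Sum>s\<in>S. G s)"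
    by (rule fps_ext)
      (simp add: gf_uniquely_determined_def G S_def fps_sum_nth num_uniquely_determined_eq[OF assms, of m])
  ultimately show ?thesis using rational_fps_of_shift by metis
qed

end
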